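(* Let $\{X_s : s\in S\}$ be a family of spaces and let $X=\bigoplus_{s\in S}X_s$ be its topological sum. For $i=1,2,3$, $X$ is $CT_i$ if and only if each $X_s$ is $CT_i$. Moreover, $X$ is $CT_4$ if and only if $S$ is finite and each $X_s$ is $CT_4$.
   Context: All topological spaces are assumed to be $T_1$ and non-empty (in particular each $X_s$ is non-empty and $S\neq\emptyset$). For a space $X$, $\mathrm{Cld}(X)$ denotes the set of all non-empty closed subsets of $X$, endowed with the Vietoris topology, i.e. the topology having as a subbase all sets $U^-=\{F\in\mathrm{Cld}(X): F\cap U\neq\emptyset\}$ and $U^+=\{F\in\mathrm{Cld}(X): F\subseteq U\}$ with $U$ open in $X$. Let $\mathcal{T}_4(X)=\{(F_1,F_2)\in\mathrm{Cld}(X)^2: F_1\cap F_2=\emptyset\}$, $\mathcal{T}_3(X)=\{(F_1,F_2)\in\mathcal{T}_4(X): F_1\text{ is a singleton}\}$, $\mathcal{T}_2(X)=\{(F_1,F_2)\in\mathcal{T}_4(X): F_1,F_2\text{ are singletons}\}$, all with the subspace topology from the product space $\mathrm{Cld}(X)^2$. For $i=2,3,4$, $X$ is called $CT_i$ if there is a continuous map $\phi=(\phi_1,\phi_2):\mathcal{T}_i(X)\to\mathrm{Cld}(X)^2$ such that for every $(F_1,F_2)\in\mathcal{T}_i(X)$: $\phi_1(F_1,F_2)\cup\phi_2(F_1,F_2)=X$ and $F_j\cap\phi_j(F_1,F_2)=\emptyset$ for $j=1,2$. $X$ is called $CT_1$ if there is a continuous map $\phi=(\phi_1,\phi_2):X^2\setminus\{(x,x):x\in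 X\}\to\mathrm{Cld}(X)^2$ such that for all $x_1\neq x_2$ in $X$: $x_1\notin\phi_1(x_1,x_2)$, $x_2\notin\phi_2(x_1,x_2)$, $x_1\in\phi_2(x_1,x_2)$ and $x_2\in\phi_1(x_1,x_2)$. *)

theory Defs
  imports "HOL-Analysis.Analysis"
begin

definition Cld :: "'a topology \<Rightarrow> 'a set set" where
  "Cld X = {F. closedin X F \<and> F \<noteq> {}}"

definition vietoris_topology :: "'a topology \<Rightarrow> 'a set topology" where
  "vietoris_topology X = topology_generated_by
     ({{F \<in> Cld X. F \<inter> U \<noteq> {}} | U. openin X U} \<union>
      {{F \<in> Cld X. F \<subseteq> U} | U. openin X U})"

lemma topspace_vietoris_topology [simp]: "topspace (vietoris_topology X) = Cld X"
proof -
  have "Cld X = {F \<in> Cld X. F \<subseteq> topspace X}"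
    by (auto simp: Cld_def dest: closedin_subset)
  then show ?thesis
    unfolding vietoris_topology_def topology_generated_by_topspace
    by blast
qed

abbreviation Cld_square :: "'a topology \<Rightarrow> ('a set \<times> 'a set) topology" where
  "Cld_square X \<equiv> prod_topology (vietoris_topology X) (vietoris_topology X)"

definition T4_pairs :: "'a topology \<Rightarrow> ('a set \<times> 'a set) set" where
  "T4_pairs X = {(F1, F2). F1 \<in> Cld X \<and> F2 \<in> Cld X \<and> F1 \<inter> F2 = {}}"

definition T3_pairs :: "'a topology \<Rightarrow> ('a set \<times> 'a set) set" where
  "T3_pairs X = {(F1, F2) \<in> T4_pairs X. is_singleton F1}"

definition T2_pairs :: "'a topology \<Rightarrow> ('a set \<times> 'a set) set" where
  "T2_pairs X = {(F1, F2) \<in> T4_pairs X. is_singleton F1 \<and> is_singleton F2}"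

text \<open>The condition shared by \<open>CT\<^sub>2\<close>, \<open>CT\<^sub>3\<close> and \<open>CT\<^sub>4\<close>, which differ only in the
  set \<open>T\<close> of pairs to be separated.\<close>

definition continuously_separates :: "'a topology \<Rightarrow> ('a set \<times> 'a set) set \<Rightarrow> bool" where
  "continuously_separates X T \<longleftrightarrow>
     (\<exists>\<phi>. continuous_map (subtopology (Cld_square X) T) (Cld_square X) \<phi> \<and>
          (\<forall>(F1, F2) \<in> T.
             fst (\<phi> (F1, F2)) \<union> snd (\<phi> (F1, F2)) = topspace X \<and>
             F1 \<inter> fst (\<phi> (F1, F2)) = {} \<and>
             F2 \<inter> snd (\<phi> (F1, F2)) = {}))"

definition CT4 :: "'a topology \<Rightarrow> bool" where
  "CT4 X \<longleftrightarrow> continuously_separates X (T4_pairs X)"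

definition CT3 :: "'a topology \<Rightarrow> bool" where
  "CT3 X \<longleftrightarrow> continuously_separates X (T3_pairs X)"

definition CT2 :: "'a topology \<Rightarrow> bool" where
  "CT2 X \<longleftrightarrow> continuously_separates X (T2_pairs X)"

definition CT1 :: "'a topology \<Rightarrow> bool" where
  "CT1 X \<longleftrightarrow>
     (\<exists>\<phi>. continuous_map (subtopology (prod_topology X X) {(x, y). x \<noteq> y}) (Cld_square X) \<phi> \<and>
          (\<forall>x1 \<in> topspace X. \<forall>x2 \<in> topspace X. x1 \<noteq> x2 \<longrightarrow>
             x1 \<notin> fst (\<phi> (x1, x2)) \<and> x2 \<notin> snd (\<phi> (x1, x2)) \<and>
             x1 \<in> snd (\<phi> (x1, x2)) \<and> x2 \<in> fst (\<phi> (x1, x2))))"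

end

theory Submission imports Defs begin

text \<open>
  All four properties are instances of one: a continuous map \<open>(P, Q)\<close> on a set \<open>T\<close> of pairs
  \<open>(F\<^sub>1, F\<^sub>2)\<close> of closed sets with \<open>F\<^sub>1 \<inter> P = F\<^sub>2 \<inter> Q = {}\<close>, \<open>F\<^sub>1 \<subseteq> Q\<close> and \<open>F\<^sub>2 \<subseteq> P\<close>, with or
  without the demand that \<open>P \<union> Q\<close> is the whole space (predicate \<open>cont_sep\<close>). For \<open>CT\<^sub>2\<close>, \<open>CT\<^sub>3\<close>,
  \<open>CT\<^sub>4\<close> the covering condition is demanded, and it implies the two inclusions. For \<open>CT\<^sub>1\<close> it is
  dropped, and points of the \<open>T\<^sub>1\<close> space are identified with singletons, so \<open>T\<close> is the same
  as for \<open>CT\<^sub>2\<close> (\<open>CT1_iff\<close>).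

  From the sum to a summand (\<open>cont_sep_summand\<close>): a closed subset of \<open>X\<^sub>s\<close> is closed in the sum,
  and intersecting with the clopen piece \<open>X\<^sub>s\<close> is continuous on the closed sets that meet it.
  The values \<open>P\<close> and \<open>Q\<close> do meet it, because they contain \<open>F\<^sub>2\<close> and \<open>F\<^sub>1\<close>.

  From the summands to the sum (\<open>cont_sep_sum\<close>): on a piece \<open>X\<^sub>s\<close> that meets both \<open>F\<^sub>1\<close> and \<open>F\<^sub>2\<close>
  use the given map of \<open>X\<^sub>s\<close>; a piece that meets only \<open>F\<^sub>1\<close> goes to \<open>Q\<close>, and a piece that misses
  \<open>F\<^sub>1\<close> goes to \<open>P\<close>. The only obstacle to continuity is the condition \<open>P \<subseteq> U\<close> (and likewise
  \<open>Q \<subseteq> U\<close>) for open \<open>U\<close>, which speaks of all pieces at once. If \<open>F\<^sub>1\<close> meets only finitely many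
  pieces, then near \<open>(F\<^sub>1, F\<^sub>2)\<close> all other pieces contribute a constant, and the condition is a
  finite intersection of open ones. This covers singletons \<open>F\<^sub>1\<close> and any index set, or arbitrary \<open>F\<^sub>1\<close> and a finite index set.

  If the index set is infinite, the sum has a continuous surjection \<open>f\<close> onto the discrete space of
  natural numbers, and this excludes \<open>CT\<^sub>4\<close> (\<open>not_CT4_if_onto_nat\<close>). For a partition of the
  naturals into non-empty \<open>A\<close> and \<open>B\<close> the closed sets \<open>f\<^sup>-\<^sup>1 A\<close> and \<open>f\<^sup>-\<^sup>1 B\<close> cover the space, so
  the map must send this pair to \<open>(f\<^sup>-\<^sup>1 B, f\<^sup>-\<^sup>1 A)\<close>. These values are clopen, so by continuity
  finite \<open>A' \<subseteq> A\<close> and \<open>B' \<subseteq> B\<close> exist such that the value at \<open>(f\<^sup>-\<^sup>1 A', f\<^sup>-\<^sup>1 B')\<close> is contained in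
  \<open>(f\<^sup>-\<^sup>1 B, f\<^sup>-\<^sup>1 A)\<close> and hence, by the covering condition, equal to it. Thus \<open>(A', B')\<close>
  determines \<open>A\<close>; but there are uncountably many partitions and only countably many pairs of
  finite sets.
\<close>

section \<open>Continuity with respect to the Vietoris topology\<close>

lemma openin_vietoris_hit: "openin X U \<Longrightarrow> openin (vietoris_topology X) {F \<in> Cld X. F \<inter> U \<noteq> {}}"
  unfolding vietoris_topology_def by (rule topology_generated_by_Basis) blast

lemma openin_vietoris_inside: "openin X U \<Longrightarrow> openin (vietoris_topology X) {F \<in> Cld X. F \<subseteq> U}"
  unfolding vietoris_topology_def by (rule topology_generated_by_Basis) blast

lemma continuous_map_vietoris_iff:
  "continuous_map Z (vietoris_topology X) f \<longleftrightarrow>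
     (\<forall>z \<in> topspace Z. f z \<in> Cld X) \<and>
     (\<forall>U. openin X U \<longrightarrow> openin Z {z \<in> topspace Z. f z \<inter> U \<noteq> {}} \<and>
                          openin Z {z \<in> topspace Z. f z \<subseteq> U})"
  (is "?L \<longleftrightarrow> ?R")
proof
  assume f: ?L
  then have im: "f z \<in> Cld X" if "z \<in> topspace Z" for z
    using that by (auto simp: continuous_map_def)
  have "openin Z {z \<in> topspace Z. f z \<inter> U \<noteq> {}}" "openin Z {z \<in> topspace Z. f z \<subseteq> U}"
    if "openin X U" for U
    using openin_continuous_map_preimage[OF f openin_vietoris_hit[OF that]]
      openin_continuous_map_preimage[OF f openin_vietoris_inside[OF that]]
    by (auto simp: im cong: conj_cong)
  with im show ?R by blast
next
  assume R: ?R
  have eq: "f -` {F \<in> Cld X. P F} \<inter> topspace Z = {z \<in> topspace Z. P (f z)}" for P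
    using R by auto
  have "openin Z (f -` W \<inter> topspace Z)"
    if "W \<in> {{F \<in> Cld X. F \<inter> U \<noteq> {}} | U. openin X U} \<union>
      {{F \<in> Cld X. F \<subseteq> U} | U. openin X U}" for W
    using that R unfolding Un_iff mem_Collect_eq by (elim disjE exE conjE) (simp_all only: eq)
  moreover have "f ` topspace Z \<subseteq> \<Union> ({{F \<in> Cld X. F \<inter> U \<noteq> {}} | U. openin X U} \<union>
      {{F \<in> Cld X. F \<subseteq> U} | U. openin X U})"
    using R topspace_vietoris_topology[of X]
    unfolding vietoris_topology_def topology_generated_by_topspace by auto
  ultimately show ?L
    unfolding vietoris_topology_def continuous_on_generated_topo_iff by blast
qed

lemma Cld_image:
  assumes "closed_map X Y f" "F \<in> Cld X"
  shows "f ` F \<in> Cld Y"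
  using assms by (auto simp: Cld_def closed_map_def)

lemma continuous_map_vietoris_image:
  assumes f: "continuous_map X Y f" and cl: "closed_map X Y f"
  shows "continuous_map (vietoris_topology X) (vietoris_topology Y) ((`) f)"
proof -
  have "openin (vietoris_topology X) {F \<in> Cld X. f ` F \<inter> U \<noteq> {}}"
    "openin (vietoris_topology X) {F \<in> Cld X. f ` F \<subseteq> U}" if "openin Y U" for U
  proof -
    have o: "openin X {x \<in> topspace X. f x \<in> U}"
      using f that by (rule openin_continuous_map_preimage)
    have sub: "F \<subseteq> topspace X" if "F \<in> Cld X" for F
      using that by (auto simp: Cld_def dest: closedin_subset)
    have "{F \<in> Cld X. f ` F \<inter> U \<noteq> {}} = {F \<in> Cld X. F \<inter> {x \<in> topspace X. f x \<in> U} \<noteq> {}}"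
      "{F \<in> Cld X. f ` F \<subseteq> U} = {F \<in> Cld X. F \<subseteq> {x \<in> topspace X. f x \<in> U}}"
      using sub by blast+
    then show "openin (vietoris_topology X) {F \<in> Cld X. f ` F \<inter> U \<noteq> {}}"
      "openin (vietoris_topology X) {F \<in> Cld X. f ` F \<subseteq> U}"
      using openin_vietoris_hit[OF o] openin_vietoris_inside[OF o] by simp_all
  qed
  then show ?thesis
    unfolding continuous_map_vietoris_iff using Cld_image[OF cl] by simp
qed

section \<open>Closed subsets of a topological sum\<close>

text \<open>The trace of a subset \<open>F\<close> of the sum on the summand \<open>X s\<close> is written \<open>Pair s -` F\<close>.\<close>

lemma closedin_slice:
  assumes "F \<in> Cld (sum_topology X S)" "s \<in> S"
  shows "closedin (X s) (Pair s -` F)"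
  using assms by (auto simp: Cld_def closedin_sum_topology vimage_def)

lemma Cld_sum_subset: "F \<in> Cld (sum_topology X S) \<Longrightarrow> F \<subseteq> Sigma S (\<lambda>s. topspace (X s))"
  unfolding Cld_def using closedin_subset by fastforce

lemma openin_sum_image_Pair:
  assumes "openin (X s) U" "s \<in> S"
  shows "openin (sum_topology X S) (Pair s ` U)"
  using assms(1) open_map_component_injection[OF assms(2), of X] by (simp add: open_map_def)

lemma openin_sum_replace:
  assumes "openin (X s) U" "s \<in> S"
  shows "openin (sum_topology X S) (Sigma S ((\<lambda>t. topspace (X t))(s := U)))"
  using assms by (simp add: openin_disjoint_union)

text \<open>The trace on a summand has to be non-empty to be a point of its hyperspace.\<close>

lemma continuous_map_vietoris_slice:
  assumes s: "s \<in> S"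
  shows "continuous_map
     (subtopology (vietoris_topology (sum_topology X S)) {F. Pair s -` F \<noteq> {}})
     (vietoris_topology (X s)) (vimage (Pair s))"
  unfolding continuous_map_vietoris_iff
proof (intro conjI ballI allI impI)
  fix F assume "F \<in> topspace (subtopology (vietoris_topology (sum_topology X S)) {F. Pair s -` F \<noteq> {}})"
  then show "Pair s -` F \<in> Cld (X s)"
    using s closedin_slice[of F X S s] by (auto simp: Cld_def)
next
  fix U assume U: "openin (X s) U"
  let ?Z = "subtopology (vietoris_topology (sum_topology X S)) {F. Pair s -` F \<noteq> {}}"
  have "{F \<in> topspace ?Z. Pair s -` F \<inter> U \<noteq> {}} =
     {F \<in> Cld (sum_topology X S). F \<inter> Pair s ` U \<noteq> {}} \<inter> {F. Pair s -` F \<noteq> {}}"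
    by auto
  then show "openin ?Z {F \<in> topspace ?Z. Pair s -` F \<inter> U \<noteq> {}}"
    using openin_vietoris_hit[OF openin_sum_image_Pair[where X = X and s = s and S = S, OF U s]]
    by (auto simp: openin_subtopology)
  have "{F \<in> topspace ?Z. Pair s -` F \<subseteq> U} =
     {F \<in> Cld (sum_topology X S). F \<subseteq> Sigma S ((\<lambda>t. topspace (X t))(s := U))} \<inter> {F. Pair s -` F \<noteq> {}}"
  proof -
    have "Pair s -` F \<subseteq> U \<longleftrightarrow> F \<subseteq> Sigma S ((\<lambda>t. topspace (X t))(s := U))"
      if "F \<in> Cld (sum_topology X S)" for F
      using Cld_sum_subset[OF that] s by (auto simp: subset_iff split: if_splits)
    then show ?thesis by auto
  qed
  then show "openin ?Z {F \<in> topspace ?Z. Pair s -` F \<subseteq> U}"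
    using openin_vietoris_inside[OF openin_sum_replace[where X = X and s = s and S = S, OF U s]]
    by (auto simp: openin_subtopology)
qed

text \<open>A map into the hyperspace of the sum may be checked summand by summand, provided that locally
  all but finitely many of the components \<open>G s\<close> are constant; the traces \<open>G s z\<close> may be empty.\<close>

lemma continuous_map_into_vietoris_sum:
  assumes cl: "\<And>z s. \<lbrakk>z \<in> topspace Z; s \<in> S\<rbrakk> \<Longrightarrow> closedin (X s) (G s z)"
    and ne: "\<And>z. z \<in> topspace Z \<Longrightarrow> \<exists>s\<in>S. G s z \<noteq> {}"
    and hit: "\<And>s U. \<lbrakk>s \<in> S; openin (X s) U\<rbrakk> \<Longrightarrow> openin Z {z \<in> topspace Z. G s z \<inter> U \<noteq> {}}"
    and inside: "\<And>s U. \<lbrakk>s \<in> S; openin (X s) U\<rbrakk> \<Longrightarrow> openin Z {z \<in> topspace Z. G s z \<subseteq> U}"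
    and loc: "\<And>z. z \<in> topspace Z \<Longrightarrow> \<exists>N A. openin Z N \<and> z \<in> N \<and> finite A \<and> A \<subseteq> S \<and>
                 (\<forall>z'\<in>N. \<forall>s\<in>S - A. G s z' = G s z)"
  shows "continuous_map Z (vietoris_topology (sum_topology X S)) (\<lambda>z. Sigma S (\<lambda>s. G s z))"
  unfolding continuous_map_vietoris_iff
proof (intro conjI ballI allI impI)
  fix z assume "z \<in> topspace Z"
  then have "Sigma S (\<lambda>s. G s z) \<noteq> {}" and "closedin (sum_topology X S) (Sigma S (\<lambda>s. G s z))"
    using cl ne by (blast, simp add: closedin_disjoint_union)
  then show "Sigma S (\<lambda>s. G s z) \<in> Cld (sum_topology X S)"
    by (simp add: Cld_def)
next
  fix U assume U: "openin (sum_topology X S) U"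
  have Us: "openin (X s) (Pair s -` U)" if "s \<in> S" for s
    using U that by (simp add: openin_sum_topology vimage_def)
  have "{z \<in> topspace Z. Sigma S (\<lambda>s. G s z) \<inter> U \<noteq> {}} =
     (\<Union>s\<in>S. {z \<in> topspace Z. G s z \<inter> Pair s -` U \<noteq> {}})"
    by blast
  then show "openin Z {z \<in> topspace Z. Sigma S (\<lambda>s. G s z) \<inter> U \<noteq> {}}"
    using hit Us by (auto intro!: openin_Union)
  show "openin Z {z \<in> topspace Z. Sigma S (\<lambda>s. G s z) \<subseteq> U}"
  proof (subst openin_subopen, intro ballI)
    fix z assume z: "z \<in> {z \<in> topspace Z. Sigma S (\<lambda>s. G s z) \<subseteq> U}"
    then have "z \<in> topspace Z" by simp
    from loc[OF this] obtain N A where N: "openin Z N" "z \<in> N" "finite A" "A \<subseteq> S"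
      and const: "\<forall>z'\<in>N. \<forall>s\<in>S - A. G s z' = G s z"
      by (elim exE conjE)
    \<comment> \<open>outside \<open>A\<close> the inclusion at \<open>z\<close> carries over to all of \<open>N\<close>, so only \<open>A\<close> matters\<close>
    define W where "W = N \<inter> {z' \<in> topspace Z. \<forall>s\<in>A. G s z' \<subseteq> Pair s -` U}"
    have "openin Z {z' \<in> topspace Z. \<forall>s\<in>A. G s z' \<subseteq> Pair s -` U}"
    proof (cases "A = {}")
      case False
      then have "{z' \<in> topspace Z. \<forall>s\<in>A. G s z' \<subseteq> Pair s -` U} =
          (\<Inter>s\<in>A. {z' \<in> topspace Z. G s z' \<subseteq> Pair s -` U})" by blast
      then show ?thesis
        using False N inside Us by (auto intro!: openin_Inter)
    qed simp
    then have "openin Z W" unfolding W_def using N by blast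
    moreover have "z \<in> W" using z N by (auto simp: W_def)
    moreover have "W \<subseteq> {z \<in> topspace Z. Sigma S (\<lambda>s. G s z) \<subseteq> U}"
    proof (clarify)
      fix w assume w: "w \<in> W"
      have "G s w \<subseteq> Pair s -` U" if "s \<in> S" for s
      proof (cases "s \<in> A")
        case True with w show ?thesis by (auto simp: W_def)
      next
        case False with w that const z show ?thesis by (auto simp: W_def)
      qed
      with w show "w \<in> topspace Z \<and> Sigma S (\<lambda>s. G s w) \<subseteq> U" by (auto simp: W_def)
    qed
    ultimately show "\<exists>T. openin Z T \<and> z \<in> T \<and> T \<subseteq> {z \<in> topspace Z. Sigma S (\<lambda>s. G s z) \<subseteq> U}"
      by blast
  qed
qed

section \<open>Continuous separation of pairs of closed sets\<close>

text \<open>The pair \<open>P\<close> separates the pair \<open>F\<close>. The flag \<open>b\<close> says whether the two members of \<open>P\<close> have to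
  cover the space. With covering, the two inclusions are redundant for subsets of the space;
  without it they are the conditions of \<open>CT\<^sub>1\<close>.\<close>

definition separating :: "bool \<Rightarrow> 'a topology \<Rightarrow> 'a set \<times> 'a set \<Rightarrow> 'a set \<times> 'a set \<Rightarrow> bool" where
  "separating b X F P \<longleftrightarrow>
     fst F \<inter> fst P = {} \<and> snd F \<inter> snd P = {} \<and> fst F \<subseteq> snd P \<and> snd F \<subseteq> fst P \<and>
     (b \<longrightarrow> fst P \<union> snd P = topspace X)"

text \<open>The pairs in \<open>T\<close> can be separated by a pair that depends continuously on them.\<close>

definition cont_sep :: "bool \<Rightarrow> 'a topology \<Rightarrow> ('a set \<times> 'a set) set \<Rightarrow> bool" where
  "cont_sep b X T \<longleftrightarrow>
     (\<exists>\<phi>. continuous_map (subtopology (Cld_square X) T) (Cld_square X) \<phi> \<and>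
          (\<forall>F \<in> T. separating b X F (\<phi> F)))"

lemma cont_sepE:
  assumes "cont_sep b X T"
  obtains \<phi> where
    "continuous_map (subtopology (Cld_square X) T) (vietoris_topology X) (\<lambda>F. fst (\<phi> F))"
    "continuous_map (subtopology (Cld_square X) T) (vietoris_topology X) (\<lambda>F. snd (\<phi> F))"
    "\<And>F. F \<in> T \<Longrightarrow> separating b X F (\<phi> F)"
  using assms unfolding cont_sep_def continuous_map_pairwise o_def by blast

lemma cont_sepI:
  assumes "continuous_map (subtopology (Cld_square X) T) (vietoris_topology X) P"
    "continuous_map (subtopology (Cld_square X) T) (vietoris_topology X) Q"
    "\<And>F. F \<in> T \<Longrightarrow> separating b X F (P F, Q F)"
  shows "cont_sep b X T"
  unfolding cont_sep_def continuous_map_pairwise o_def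
  by (rule exI[of _ "\<lambda>F. (P F, Q F)"]) (use assms in auto)

lemma T4_pairs_subset: "T4_pairs X \<subseteq> Cld X \<times> Cld X"
  by (auto simp: T4_pairs_def)

lemma T4_pairs_subset_topspace:
  "F \<in> T4_pairs X \<Longrightarrow> fst F \<subseteq> topspace X \<and> snd F \<subseteq> topspace X"
  by (auto simp: T4_pairs_def Cld_def dest!: closedin_subset)

lemma continuously_separates_iff:
  assumes T: "T \<subseteq> T4_pairs X"
  shows "continuously_separates X T \<longleftrightarrow> cont_sep True X T"
proof -
  have "(case F of (F1, F2) \<Rightarrow> fst (\<phi> (F1, F2)) \<union> snd (\<phi> (F1, F2)) = topspace X \<and>
           F1 \<inter> fst (\<phi> (F1, F2)) = {} \<and> F2 \<inter> snd (\<phi> (F1, F2)) = {})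
        \<longleftrightarrow> separating True X F (\<phi> F)" if "F \<in> T" for F \<phi>
  proof -
    have "fst F \<subseteq> topspace X" "snd F \<subseteq> topspace X"
      using T4_pairs_subset_topspace that T by blast+
    then show ?thesis
      by (cases F) (auto simp: separating_def)
  qed
  then show ?thesis
    unfolding continuously_separates_def cont_sep_def by (metis (no_types, lifting))
qed

section \<open>Restriction to a summand\<close>

lemma cont_sep_summand:
  fixes X :: "'s \<Rightarrow> 'a topology"
  assumes c: "cont_sep b (sum_topology X S) T'" and s: "s \<in> S"
    and T: "T \<subseteq> Cld (X s) \<times> Cld (X s)"
    and ext: "\<And>F. F \<in> T \<Longrightarrow> map_prod ((`) (Pair s)) ((`) (Pair s)) F \<in> T'"
  shows "cont_sep b (X s) T"
proof -
  let ?Z = "subtopology (Cld_square (X s)) T"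
  let ?\<Sigma> = "sum_topology X S"
  let ?e = "map_prod ((`) (Pair s)) ((`) (Pair s)) :: 'a set \<times> 'a set \<Rightarrow> _"
  obtain \<phi> where
    \<phi>1: "continuous_map (subtopology (Cld_square ?\<Sigma>) T') (vietoris_topology ?\<Sigma>) (\<lambda>F. fst (\<phi> F))" and
    \<phi>2: "continuous_map (subtopology (Cld_square ?\<Sigma>) T') (vietoris_topology ?\<Sigma>) (\<lambda>F. snd (\<phi> F))" and
    sep: "\<And>F. F \<in> T' \<Longrightarrow> separating b ?\<Sigma> F (\<phi> F)"
    using cont_sepE[OF c] by metis
  have topZ: "topspace ?Z = T" using T by auto
  have "continuous_map (vietoris_topology (X s)) (vietoris_topology ?\<Sigma>) ((`) (Pair s))"
    by (intro continuous_map_vietoris_image continuous_map_component_injection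
        closed_map_component_injection s)
  then have "continuous_map (Cld_square (X s)) (Cld_square ?\<Sigma>) ?e"
    by (simp add: map_prod_def continuous_map_prod_top)
  then have e: "continuous_map ?Z (subtopology (Cld_square ?\<Sigma>) T') ?e"
    using topZ ext by (intro continuous_map_into_subtopology continuous_map_from_subtopology) auto
  have sl: "separating b (X s) F (Pair s -` fst (\<phi> (?e F)), Pair s -` snd (\<phi> (?e F)))" if "F \<in> T" for F
  proof -
    have s': "fst (\<phi> (?e F)) \<union> snd (\<phi> (?e F)) = Sigma S (topspace \<circ> X) \<Longrightarrow>
        Pair s -` fst (\<phi> (?e F)) \<union> Pair s -` snd (\<phi> (?e F)) = topspace (X s)"
      using s unfolding vimage_Un[symmetric] by auto
    show ?thesis
      using sep[OF ext[OF that]] s' by (cases F) (auto simp: separating_def)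
  qed
  have ne: "fst F \<noteq> {}" "snd F \<noteq> {}" if "F \<in> T" for F
    using that T by (auto simp: Cld_def)
  \<comment> \<open>the separating sets meet the summand since they contain the embedded \<open>snd F\<close> and \<open>fst F\<close>\<close>
  have meet: "Pair s -` fst (\<phi> (?e F)) \<noteq> {}" "Pair s -` snd (\<phi> (?e F)) \<noteq> {}" if "F \<in> T" for F
    using sl[OF that] ne[OF that] unfolding separating_def fst_conv snd_conv by blast+
  have "continuous_map ?Z (vietoris_topology (X s)) (\<lambda>F. Pair s -` fst (\<phi> (?e F)))"
  proof -
    have "continuous_map ?Z (subtopology (vietoris_topology ?\<Sigma>) {F. Pair s -` F \<noteq> {}})
        (\<lambda>F. fst (\<phi> (?e F)))"
    proof (rule continuous_map_into_subtopology)
      show "continuous_map ?Z (vietoris_topology ?\<Sigma>) (\<lambda>F. fst (\<phi> (?e F)))"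
        using continuous_map_compose[OF e \<phi>1] by (simp add: o_def)
      show "(\<lambda>F. fst (\<phi> (?e F))) \<in> topspace ?Z \<rightarrow> {F. Pair s -` F \<noteq> {}}"
        unfolding topZ using meet by blast
    qed
    from continuous_map_compose[OF this continuous_map_vietoris_slice[OF s]]
    show ?thesis by (simp add: o_def)
  qed
  moreover have "continuous_map ?Z (vietoris_topology (X s)) (\<lambda>F. Pair s -` snd (\<phi> (?e F)))"
  proof -
    have "continuous_map ?Z (subtopology (vietoris_topology ?\<Sigma>) {F. Pair s -` F \<noteq> {}})
        (\<lambda>F. snd (\<phi> (?e F)))"
    proof (rule continuous_map_into_subtopology)
      show "continuous_map ?Z (vietoris_topology ?\<Sigma>) (\<lambda>F. snd (\<phi> (?e F)))"
        using continuous_map_compose[OF e \<phi>2] by (simp add: o_def)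
      show "(\<lambda>F. snd (\<phi> (?e F))) \<in> topspace ?Z \<rightarrow> {F. Pair s -` F \<noteq> {}}"
        unfolding topZ using meet by blast
    qed
    from continuous_map_compose[OF this continuous_map_vietoris_slice[OF s]]
    show ?thesis by (simp add: o_def)
  qed
  ultimately show ?thesis
    using sl by (rule cont_sepI)
qed

section \<open>Gluing the maps of the summands\<close>

lemma openin_vietoris_slice_nonempty:
  assumes s: "s \<in> S"
  shows "openin (vietoris_topology (sum_topology X S)) {F \<in> Cld (sum_topology X S). Pair s -` F \<noteq> {}}"
proof -
  have "{F \<in> Cld (sum_topology X S). Pair s -` F \<noteq> {}} =
        {F \<in> Cld (sum_topology X S). F \<inter> Pair s ` topspace (X s) \<noteq> {}}"
    using Cld_sum_subset[of _ X S] by fast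
  then show ?thesis
    using openin_vietoris_hit[OF openin_sum_image_Pair[where X = X and s = s and S = S, OF openin_topspace s]]
    by simp
qed

lemma openin_vietoris_support_subset:
  "openin (vietoris_topology (sum_topology X S))
     {F \<in> Cld (sum_topology X S). \<forall>s. Pair s -` F \<noteq> {} \<longrightarrow> s \<in> A}"
proof -
  have "{F \<in> Cld (sum_topology X S). \<forall>s. Pair s -` F \<noteq> {} \<longrightarrow> s \<in> A} =
        {F \<in> Cld (sum_topology X S). F \<subseteq> Sigma S (\<lambda>s. if s \<in> A then topspace (X s) else {})}"
    using Cld_sum_subset[of _ X S] by (fastforce split: if_splits)
  moreover have "openin (sum_topology X S) (Sigma S (\<lambda>s. if s \<in> A then topspace (X s) else {}))"
    by (simp add: openin_disjoint_union)
  ultimately show ?thesis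
    by (simp only: openin_vietoris_inside)
qed

text \<open>The set \<open>D s\<close> consists of the pairs of which both members meet \<open>X s\<close>; only there a continuous
  map \<open>g s\<close> is given. Elsewhere the component in \<open>X s\<close> is one of two fixed closed sets: \<open>L s\<close>
  if \<open>fst F\<close> meets \<open>X s\<close>, and \<open>K s\<close> otherwise. Each of the three cases is an open condition.\<close>

lemma continuous_map_glue_pieces:
  fixes X :: "'s \<Rightarrow> 'a topology" and S T
  defines "Z \<equiv> subtopology (Cld_square (sum_topology X S)) T"
  assumes D_def: "\<And>s. D s = {F \<in> T. Pair s -` fst F \<noteq> {} \<and> Pair s -` snd F \<noteq> {}}"
    and G_def: "\<And>s F. G s F = (if F \<in> D s then g s F else if Pair s -` fst F \<noteq> {} then L s else K s)"
    and T: "T \<subseteq> Cld (sum_topology X S) \<times> Cld (sum_topology X S)"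
    and fin: "\<And>F. F \<in> T \<Longrightarrow> finite {s. Pair s -` fst F \<noteq> {}}"
    and g: "\<And>s. s \<in> S \<Longrightarrow> continuous_map (subtopology Z (D s)) (vietoris_topology (X s)) (g s)"
    and K: "\<And>s. s \<in> S \<Longrightarrow> closedin (X s) (K s)" "\<And>s. s \<in> S \<Longrightarrow> closedin (X s) (L s)"
    and ne: "\<And>F. F \<in> T \<Longrightarrow> Sigma S (\<lambda>s. G s F) \<noteq> {}"
  shows "continuous_map Z (vietoris_topology (sum_topology X S)) (\<lambda>F. Sigma S (\<lambda>s. G s F))"
proof -
  let ?\<Sigma> = "sum_topology X S"
  have topZ: "topspace Z = T" using T by (auto simp: Z_def)
  have c1: "continuous_map Z (vietoris_topology ?\<Sigma>) fst"
    and c2: "continuous_map Z (vietoris_topology ?\<Sigma>) snd"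
    unfolding Z_def by (auto intro: continuous_map_from_subtopology continuous_map_fst continuous_map_snd)
  have in_T: "fst F \<in> Cld ?\<Sigma>" "snd F \<in> Cld ?\<Sigma>" if "F \<in> T" for F
    using that T by auto
  have E: "openin Z {F \<in> T. Pair s -` fst F \<noteq> {}}" "openin Z {F \<in> T. Pair s -` snd F \<noteq> {}}"
    if "s \<in> S" for s
    using openin_continuous_map_preimage[OF c1 openin_vietoris_slice_nonempty[OF that]]
      openin_continuous_map_preimage[OF c2 openin_vietoris_slice_nonempty[OF that]] in_T
    by (simp_all add: topZ cong: conj_cong)
  have supp: "openin Z {F \<in> T. \<forall>s. Pair s -` fst F \<noteq> {} \<longrightarrow> s \<in> A}"
     "openin Z {F \<in> T. \<forall>s. Pair s -` snd F \<noteq> {} \<longrightarrow> s \<in> A}" for A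
    using openin_continuous_map_preimage[OF c1 openin_vietoris_support_subset[where A = A]]
      openin_continuous_map_preimage[OF c2 openin_vietoris_support_subset[where A = A]] in_T
    by (simp_all add: topZ cong: conj_cong)
  have E0: "openin Z {F \<in> T. Pair s -` fst F = {}}" "openin Z {F \<in> T. Pair s -` snd F = {}}" for s
  proof -
    have "{F \<in> T. Pair s -` p F = {}} = {F \<in> T. \<forall>t. Pair t -` p F \<noteq> {} \<longrightarrow> t \<in> - {s}}"
      for p :: "_ \<Rightarrow> ('s \<times> 'a) set" by auto
    then show "openin Z {F \<in> T. Pair s -` fst F = {}}" "openin Z {F \<in> T. Pair s -` snd F = {}}"
      using supp[of "- {s}"] by simp_all
  qed
  have D: "openin Z (D s)" if "s \<in> S" for s
  proof -
    have "D s = {F \<in> T. Pair s -` fst F \<noteq> {}} \<inter> {F \<in> T. Pair s -` snd F \<noteq> {}}"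
      by (auto simp: D_def)
    then show ?thesis using E[OF that] by auto
  qed
  have D1: "openin Z {F \<in> T. Pair s -` fst F \<noteq> {} \<and> Pair s -` snd F = {}}" if "s \<in> S" for s
    using openin_Int[OF E(1)[OF that] E0(2)[of s]] by (simp add: Collect_conj_eq Int_ac)
  have topD: "topspace (subtopology Z (D s)) = D s" for s
    unfolding topspace_subtopology topZ by (auto simp: D_def)
  have gopen: "openin Z {F \<in> D s. g s F \<inter> U \<noteq> {}}" "openin Z {F \<in> D s. g s F \<subseteq> U}"
    if "s \<in> S" "openin (X s) U" for s U
    using g[OF that(1)] that D[OF that(1)] unfolding continuous_map_vietoris_iff topD
    by (auto intro: openin_trans_full)
  have split: "{F \<in> T. Q (G s F)} = {F \<in> D s. Q (g s F)} \<union>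
      (if Q (L s) then {F \<in> T. Pair s -` fst F \<noteq> {} \<and> Pair s -` snd F = {}} else {}) \<union>
      (if Q (K s) then {F \<in> T. Pair s -` fst F = {}} else {})" for s Q
    by (auto simp: G_def D_def)
  show ?thesis
  proof (rule continuous_map_into_vietoris_sum, unfold topZ)
    fix F s assume "F \<in> T" "s \<in> S"
    moreover from this have "F \<in> D s \<Longrightarrow> g s F \<in> Cld (X s)"
      using g topD unfolding continuous_map_vietoris_iff by blast
    ultimately show "closedin (X s) (G s F)"
      using K by (auto simp: G_def Cld_def)
  next
    fix F assume "F \<in> T"
    from ne[OF this] show "\<exists>s\<in>S. G s F \<noteq> {}" by auto
  next
    fix s U assume sU: "s \<in> S" "openin (X s) U"
    show "openin Z {F \<in> T. G s F \<inter> U \<noteq> {}}"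
      unfolding split[of "\<lambda>A. A \<inter> U \<noteq> {}"] using gopen[OF sU] D1[OF sU(1)] E0
      by (intro openin_Un) auto
    show "openin Z {F \<in> T. G s F \<subseteq> U}"
      unfolding split[of "\<lambda>A. A \<subseteq> U"] using gopen[OF sU] D1[OF sU(1)] E0
      by (intro openin_Un) auto
  next
    fix F assume F: "F \<in> T"
    \<comment> \<open>near \<open>F\<close> the support of the first member can only shrink, and off \<open>A\<close> the value is \<open>K s\<close>\<close>
    define A where "A = {s. Pair s -` fst F \<noteq> {}}"
    define N where "N = {F \<in> T. \<forall>s. Pair s -` fst F \<noteq> {} \<longrightarrow> s \<in> A}"
    have "A \<subseteq> S" using Cld_sum_subset[OF in_T(1)[OF F]] by (auto simp: A_def)
    moreover have "finite A" using fin[OF F] by (simp add: A_def)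
    moreover have "G s F' = G s F"
      if "F' \<in> N" "s \<in> S - A" for F' s
    proof -
      have "Pair s -` fst F = {}" "Pair s -` fst F' = {}" using that by (auto simp: A_def N_def)
      then show ?thesis by (simp add: G_def D_def)
    qed
    moreover have "F \<in> N" using F by (simp add: A_def N_def)
    moreover have "openin Z N" unfolding N_def by (rule supp(1))
    ultimately show "\<exists>N A. openin Z N \<and> F \<in> N \<and> finite A \<and> A \<subseteq> S \<and>
        (\<forall>F'\<in>N. \<forall>s\<in>S - A. G s F' = G s F)"
      by (intro exI[of _ N] exI[of _ A] conjI ballI)
  qed
qed

text \<open>Summand-wise separation glues to the sum if each first member meets only finitely many
  summands.\<close>

lemma cont_sep_sum:
  fixes X :: "'s \<Rightarrow> 'a topology"
  assumes c: "\<And>s. s \<in> S \<Longrightarrow> cont_sep b (X s) (T s)"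
    and T': "T' \<subseteq> Cld (sum_topology X S) \<times> Cld (sum_topology X S)"
    and res: "\<And>F s. \<lbrakk>F \<in> T'; s \<in> S; Pair s -` fst F \<noteq> {}; Pair s -` snd F \<noteq> {}\<rbrakk>
               \<Longrightarrow> (Pair s -` fst F, Pair s -` snd F) \<in> T s"
    and fin: "\<And>F. F \<in> T' \<Longrightarrow> finite {s. Pair s -` fst F \<noteq> {}}"
  shows "cont_sep b (sum_topology X S) T'"
proof -
  let ?\<Sigma> = "sum_topology X S"
  let ?Z = "subtopology (Cld_square ?\<Sigma>) T'"
  define D where "D = (\<lambda>s. {F \<in> T'. Pair s -` fst F \<noteq> {} \<and> Pair s -` snd F \<noteq> {}})"
  define sl :: "'s \<Rightarrow> _ \<Rightarrow> 'a set \<times> 'a set"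
    where "sl = (\<lambda>s F. (Pair s -` fst F, Pair s -` snd F))"
  have "\<forall>s\<in>S. \<exists>\<phi>.
      continuous_map (subtopology (Cld_square (X s)) (T s)) (vietoris_topology (X s)) (\<lambda>F. fst (\<phi> F)) \<and>
      continuous_map (subtopology (Cld_square (X s)) (T s)) (vietoris_topology (X s)) (\<lambda>F. snd (\<phi> F)) \<and>
      (\<forall>F\<in>T s. separating b (X s) F (\<phi> F))"
    using cont_sepE[OF c] by metis
  from bchoice[OF this] obtain \<phi> where
    \<phi>1: "\<And>s. s \<in> S \<Longrightarrow> continuous_map (subtopology (Cld_square (X s)) (T s)) (vietoris_topology (X s)) (\<lambda>F. fst (\<phi> s F))" and
    \<phi>2: "\<And>s. s \<in> S \<Longrightarrow> continuous_map (subtopology (Cld_square (X s)) (T s)) (vietoris_topology (X s)) (\<lambda>F. snd (\<phi> s F))" and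
    sep: "\<And>s F. s \<in> S \<Longrightarrow> F \<in> T s \<Longrightarrow> separating b (X s) F (\<phi> s F)"
    by auto
  \<comment> \<open>a piece on which there is nothing to separate is given entirely to one side; giving it to the
    side \<open>P\<close> exactly when it misses \<open>fst F\<close> makes the choice constant away from the support of \<open>fst F\<close>\<close>
  define P where "P = (\<lambda>s F. if F \<in> D s then fst (\<phi> s (sl s F))
      else if Pair s -` fst F \<noteq> {} then {} else topspace (X s))"
  define Q where "Q = (\<lambda>s F. if F \<in> D s then snd (\<phi> s (sl s F))
      else if Pair s -` fst F \<noteq> {} then topspace (X s) else {})"
  have topD: "topspace (subtopology ?Z (D s)) = D s" for s
    using T' by (auto simp: D_def)
  have sl: "continuous_map (subtopology ?Z (D s)) (subtopology (Cld_square (X s)) (T s)) (sl s)"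
    if s: "s \<in> S" for s
  proof (rule continuous_map_into_subtopology)
    show "sl s \<in> topspace (subtopology ?Z (D s)) \<rightarrow> T s"
      unfolding topD using res s by (auto simp: D_def sl_def)
    have "continuous_map (subtopology ?Z (D s)) (subtopology (vietoris_topology ?\<Sigma>) {F. Pair s -` F \<noteq> {}}) fst"
      "continuous_map (subtopology ?Z (D s)) (subtopology (vietoris_topology ?\<Sigma>) {F. Pair s -` F \<noteq> {}}) snd"
      unfolding continuous_map_in_subtopology topD
      by (auto intro: continuous_map_from_subtopology continuous_map_fst continuous_map_snd simp: D_def)
    from this[THEN continuous_map_compose, OF continuous_map_vietoris_slice[OF s]]
    show "continuous_map (subtopology ?Z (D s)) (Cld_square (X s)) (sl s)"
      unfolding continuous_map_pairwise by (simp add: o_def sl_def)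
  qed
  have in_T': "fst F \<subseteq> Sigma S (\<lambda>s. topspace (X s))" "snd F \<subseteq> Sigma S (\<lambda>s. topspace (X s))"
    "fst F \<noteq> {}" "snd F \<noteq> {}" if "F \<in> T'" for F
  proof -
    have "fst F \<in> Cld ?\<Sigma>" "snd F \<in> Cld ?\<Sigma>" using that T' by auto
    then show "fst F \<subseteq> Sigma S (\<lambda>s. topspace (X s))" "snd F \<subseteq> Sigma S (\<lambda>s. topspace (X s))"
      "fst F \<noteq> {}" "snd F \<noteq> {}"
      by (simp_all only: Cld_sum_subset) (simp_all add: Cld_def)
  qed
  have sepD: "separating b (X s) (sl s F) (\<phi> s (sl s F))" if "F \<in> D s" "s \<in> S" for F s
    using that res by (intro sep) (auto simp: D_def sl_def)
  have piece: "separating b (X s) (sl s F) (P s F, Q s F)" if F: "F \<in> T'" and s: "s \<in> S" for F s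
  proof (cases "F \<in> D s")
    case True
    with sepD[OF True s] show ?thesis by (simp add: separating_def P_def Q_def)
  next
    case False
    then have "Pair s -` fst F = {} \<or> Pair s -` snd F = {}" using F by (auto simp: D_def)
    moreover have "Pair s -` fst F \<subseteq> topspace (X s)" "Pair s -` snd F \<subseteq> topspace (X s)"
      using in_T'[OF F] by auto
    ultimately show ?thesis using False by (auto simp: separating_def P_def Q_def sl_def)
  qed
  have sepF: "separating b ?\<Sigma> F (Sigma S (\<lambda>s. P s F), Sigma S (\<lambda>s. Q s F))" if F: "F \<in> T'" for F
  proof -
    have p: "(s, x) \<in> fst F \<Longrightarrow> s \<in> S \<and> x \<in> Q s F \<and> x \<notin> P s F"
      "(s, x) \<in> snd F \<Longrightarrow> s \<in> S \<and> x \<in> P s F \<and> x \<notin> Q s F" for s x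
      using piece[OF F, of s] in_T'(1,2)[OF F] unfolding separating_def sl_def fst_conv snd_conv
      by blast+
    have "Sigma S (\<lambda>s. P s F) \<union> Sigma S (\<lambda>s. Q s F) = Sigma S (topspace \<circ> X)" if b
      using piece[OF F] that unfolding separating_def by fastforce
    moreover have "fst F \<inter> Sigma S (\<lambda>s. P s F) = {}" "snd F \<inter> Sigma S (\<lambda>s. Q s F) = {}"
      "fst F \<subseteq> Sigma S (\<lambda>s. Q s F)" "snd F \<subseteq> Sigma S (\<lambda>s. P s F)"
      using p by fast+
    ultimately show ?thesis
      by (simp add: separating_def)
  qed
  have "continuous_map ?Z (vietoris_topology ?\<Sigma>) (\<lambda>F. Sigma S (\<lambda>s. P s F))"
  proof (rule continuous_map_glue_pieces[where D = D and g = "\<lambda>s F. fst (\<phi> s (sl s F))"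
        and L = "\<lambda>s. {}" and K = "\<lambda>s. topspace (X s)"])
    show "continuous_map (subtopology ?Z (D s)) (vietoris_topology (X s)) (\<lambda>F. fst (\<phi> s (sl s F)))"
      if "s \<in> S" for s
      using continuous_map_compose[OF sl[OF that] \<phi>1[OF that]] by (simp add: o_def)
    show "Sigma S (\<lambda>s. P s F) \<noteq> {}" if "F \<in> T'" for F
      using sepF[OF that] in_T'(4)[OF that] unfolding separating_def fst_conv snd_conv by blast
    show "P s F = (if F \<in> D s then fst (\<phi> s (sl s F))
      else if Pair s -` fst F \<noteq> {} then {} else topspace (X s))" for s F
      by (simp add: P_def)
    show "D s = {F \<in> T'. Pair s -` fst F \<noteq> {} \<and> Pair s -` snd F \<noteq> {}}" for s
      by (simp add: D_def)
  qed (use T' fin in simp_all)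
  moreover have "continuous_map ?Z (vietoris_topology ?\<Sigma>) (\<lambda>F. Sigma S (\<lambda>s. Q s F))"
  proof (rule continuous_map_glue_pieces[where D = D and g = "\<lambda>s F. snd (\<phi> s (sl s F))"
        and L = "\<lambda>s. topspace (X s)" and K = "\<lambda>s. {}"])
    show "continuous_map (subtopology ?Z (D s)) (vietoris_topology (X s)) (\<lambda>F. snd (\<phi> s (sl s F)))"
      if "s \<in> S" for s
      using continuous_map_compose[OF sl[OF that] \<phi>2[OF that]] by (simp add: o_def)
    show "Sigma S (\<lambda>s. Q s F) \<noteq> {}" if "F \<in> T'" for F
      using sepF[OF that] in_T'(3)[OF that] unfolding separating_def fst_conv snd_conv by blast
    show "Q s F = (if F \<in> D s then snd (\<phi> s (sl s F))
      else if Pair s -` fst F \<noteq> {} then topspace (X s) else {})" for s F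
      by (simp add: Q_def)
    show "D s = {F \<in> T'. Pair s -` fst F \<noteq> {} \<and> Pair s -` snd F \<noteq> {}}" for s
      by (simp add: D_def)
  qed (use T' fin in simp_all)
  ultimately show ?thesis using sepF by (rule cont_sepI)
qed

section \<open>Points as singletons\<close>

lemma continuous_map_vietoris_singleton:
  assumes "t1_space X"
  shows "continuous_map X (vietoris_topology X) (\<lambda>x. {x})"
proof -
  have "openin X {x \<in> topspace X. x \<in> U}" if "openin X U" for U
    using openin_Int[OF openin_topspace that] by (simp add: Int_def)
  then show ?thesis
    using assms unfolding continuous_map_vietoris_iff
    by (auto simp: Cld_def t1_space_closedin_singleton)
qed

lemma continuous_map_vietoris_the_elem:
  "continuous_map (subtopology (vietoris_topology X) {F. is_singleton F}) X the_elem"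
  unfolding continuous_map_def
proof (intro conjI allI impI)
  show "the_elem \<in> topspace (subtopology (vietoris_topology X) {F. is_singleton F}) \<rightarrow> topspace X"
    by (auto simp: Cld_def is_singleton_def dest: closedin_subset)
  fix U assume U: "openin X U"
  have "{F \<in> topspace (subtopology (vietoris_topology X) {F. is_singleton F}). the_elem F \<in> U} =
        {F \<in> Cld X. F \<inter> U \<noteq> {}} \<inter> {F. is_singleton F}"
    by (auto simp: is_singleton_def)
  then show "openin (subtopology (vietoris_topology X) {F. is_singleton F})
      {F \<in> topspace (subtopology (vietoris_topology X) {F. is_singleton F}). the_elem F \<in> U}"
    using openin_vietoris_hit[OF U] by (auto simp: openin_subtopology)
qed

lemma singletons_in_T2_pairs_iff:
  assumes "t1_space X"
  shows "({x}, {y}) \<in> T2_pairs X \<longleftrightarrow> x \<in> topspace X \<and> y \<in> topspace X \<and> x \<noteq> y"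
  using assms by (auto simp: T2_pairs_def T4_pairs_def Cld_def t1_space_closedin_singleton
      dest: closedin_subset)

lemma T2_pairsE:
  assumes "F \<in> T2_pairs X"
  obtains x y where "F = ({x}, {y})" "x \<in> topspace X" "y \<in> topspace X" "x \<noteq> y"
  using assms by (fastforce simp: T2_pairs_def T4_pairs_def Cld_def is_singleton_def dest: closedin_subset)

lemma CT1_iff:
  assumes t1: "t1_space X"
  shows "CT1 X \<longleftrightarrow> cont_sep False X (T2_pairs X)"
proof
  let ?Z1 = "subtopology (prod_topology X X) {(x, y). x \<noteq> y}"
  let ?Z2 = "subtopology (Cld_square X) (T2_pairs X)"
  {
    assume "CT1 X"
    then obtain \<phi> where c: "continuous_map ?Z1 (Cld_square X) \<phi>"
      and \<phi>: "\<And>x y. \<lbrakk>x \<in> topspace X; y \<in> topspace X; x \<noteq> y\<rbrakk> \<Longrightarrow>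
           separating False X ({x}, {y}) (\<phi> (x, y))"
      unfolding CT1_def separating_def by fastforce
    define j where "j = map_prod (the_elem :: 'a set \<Rightarrow> 'a) (the_elem :: 'a set \<Rightarrow> 'a)"
    have Z2: "?Z2 = subtopology (prod_topology (subtopology (vietoris_topology X) {F. is_singleton F})
          (subtopology (vietoris_topology X) {F. is_singleton F})) (T2_pairs X)"
    proof -
      have "T2_pairs X \<subseteq> {F. is_singleton F} \<times> {F. is_singleton F}"
        by (auto simp: T2_pairs_def)
      then show ?thesis
        by (simp only: subtopology_Times[symmetric] subtopology_subtopology Int_absorb1)
    qed
    have "continuous_map ?Z2 ?Z1 j"
    proof (rule continuous_map_into_subtopology)
      show "continuous_map ?Z2 (prod_topology X X) j"
        unfolding Z2 j_def map_prod_def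
        by (intro continuous_map_from_subtopology)
          (simp add: continuous_map_prod_top continuous_map_vietoris_the_elem)
      show "j \<in> topspace ?Z2 \<rightarrow> {(x, y). x \<noteq> y}"
        by (auto simp: j_def elim!: T2_pairsE)
    qed
    from continuous_map_compose[OF this c]
    have "continuous_map ?Z2 (Cld_square X) (\<lambda>F. \<phi> (j F))" by (simp add: o_def)
    moreover have "separating False X F (\<phi> (j F))" if "F \<in> T2_pairs X" for F
      using that \<phi> by (auto simp: j_def elim!: T2_pairsE)
    ultimately show "cont_sep False X (T2_pairs X)"
      unfolding cont_sep_def by blast
  next
    assume "cont_sep False X (T2_pairs X)"
    then obtain \<phi> where c: "continuous_map ?Z2 (Cld_square X) \<phi>"
      and \<phi>: "\<And>F. F \<in> T2_pairs X \<Longrightarrow> separating False X F (\<phi> F)"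
      unfolding cont_sep_def by blast
    have "continuous_map ?Z1 ?Z2 (\<lambda>(x, y). ({x}, {y}))"
    proof (rule continuous_map_into_subtopology)
      show "continuous_map ?Z1 (Cld_square X) (\<lambda>(x, y). ({x}, {y}))"
        by (intro continuous_map_from_subtopology)
          (simp add: continuous_map_prod_top continuous_map_vietoris_singleton[OF t1])
      show "(\<lambda>(x, y). ({x}, {y})) \<in> topspace ?Z1 \<rightarrow> T2_pairs X"
        by (auto simp: singletons_in_T2_pairs_iff[OF t1])
    qed
    from continuous_map_compose[OF this c]
    have "continuous_map ?Z1 (Cld_square X) (\<lambda>(x, y). \<phi> ({x}, {y}))"
      by (simp add: o_def case_prod_unfold)
    moreover have "separating False X ({x}, {y}) (\<phi> ({x}, {y}))"
      if "x \<in> topspace X" "y \<in> topspace X" "x \<noteq> y" for x y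
      using that by (intro \<phi>) (simp add: singletons_in_T2_pairs_iff[OF t1])
    ultimately show "CT1 X"
      unfolding CT1_def by (intro exI[of _ "\<lambda>(x, y). \<phi> ({x}, {y})"]) (auto simp: separating_def)
  }
qed

section \<open>The classes of pairs in a sum and in its summands\<close>

lemma t1_space_sum_topology:
  assumes "\<And>s. s \<in> S \<Longrightarrow> t1_space (X s)"
  shows "t1_space (sum_topology X S)"
  unfolding t1_space_closedin_singleton
proof
  fix p assume p: "p \<in> topspace (sum_topology X S)"
  then have "closedin (X (fst p)) {snd p}"
    using assms by (auto simp: t1_space_closedin_singleton)
  moreover have "closed_map (X (fst p)) (sum_topology X S) (Pair (fst p))"
    using p by (intro closed_map_component_injection) auto
  ultimately have "closedin (sum_topology X S) (Pair (fst p) ` {snd p})"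
    unfolding closed_map_def by blast
  then show "closedin (sum_topology X S) {p}" by simp
qed

lemma T3_pairs_iff: "F \<in> T3_pairs X \<longleftrightarrow> F \<in> T4_pairs X \<and> is_singleton (fst F)"
  by (cases F) (simp add: T3_pairs_def)

lemma T2_pairs_iff: "F \<in> T2_pairs X \<longleftrightarrow> F \<in> T4_pairs X \<and> is_singleton (fst F) \<and> is_singleton (snd F)"
  by (cases F) (simp add: T2_pairs_def)

lemma pairs_image:
  fixes X :: "'s \<Rightarrow> 'a topology"
  assumes s: "s \<in> S"
  shows "F \<in> T4_pairs (X s) \<Longrightarrow> map_prod ((`) (Pair s)) ((`) (Pair s)) F \<in> T4_pairs (sum_topology X S)"
    and "F \<in> T3_pairs (X s) \<Longrightarrow> map_prod ((`) (Pair s)) ((`) (Pair s)) F \<in> T3_pairs (sum_topology X S)"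
    and "F \<in> T2_pairs (X s) \<Longrightarrow> map_prod ((`) (Pair s)) ((`) (Pair s)) F \<in> T2_pairs (sum_topology X S)"
proof -
  let ?e = "map_prod ((`) (Pair s)) ((`) (Pair s)) :: 'a set \<times> 'a set \<Rightarrow> _"
  show 4: "?e F \<in> T4_pairs (sum_topology X S)" if "F \<in> T4_pairs (X s)"
    using that Cld_image[OF closed_map_component_injection[OF s, of X]]
    by (cases F) (auto simp: T4_pairs_def)
  have "is_singleton (Pair s ` A)" if "is_singleton A" for A :: "'a set"
    using that by (auto simp: is_singleton_def)
  then show "F \<in> T3_pairs (X s) \<Longrightarrow> ?e F \<in> T3_pairs (sum_topology X S)"
    "F \<in> T2_pairs (X s) \<Longrightarrow> ?e F \<in> T2_pairs (sum_topology X S)"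
    unfolding T3_pairs_iff T2_pairs_iff using 4 by (simp_all add: map_prod_def case_prod_unfold)
qed

lemma is_singleton_slice: "is_singleton F \<Longrightarrow> Pair s -` F \<noteq> {} \<Longrightarrow> is_singleton (Pair s -` F)"
  by (auto simp: is_singleton_def vimage_def)

lemma pairs_slice:
  assumes "s \<in> S" "Pair s -` fst F \<noteq> {}" "Pair s -` snd F \<noteq> {}"
  shows "F \<in> T4_pairs (sum_topology X S) \<Longrightarrow> (Pair s -` fst F, Pair s -` snd F) \<in> T4_pairs (X s)"
    and "F \<in> T3_pairs (sum_topology X S) \<Longrightarrow> (Pair s -` fst F, Pair s -` snd F) \<in> T3_pairs (X s)"
    and "F \<in> T2_pairs (sum_topology X S) \<Longrightarrow> (Pair s -` fst F, Pair s -` snd F) \<in> T2_pairs (X s)"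
proof -
  have "Pair s -` A \<in> Cld (X s)" if "A \<in> Cld (sum_topology X S)" "Pair s -` A \<noteq> {}" for A
    using closedin_slice[OF that(1) assms(1)] that(2) by (simp add: Cld_def)
  then show 4: "(Pair s -` fst F, Pair s -` snd F) \<in> T4_pairs (X s)"
    if "F \<in> T4_pairs (sum_topology X S)"
    using that assms by (cases F) (simp add: T4_pairs_def vimage_Int[symmetric])
  show "F \<in> T3_pairs (sum_topology X S) \<Longrightarrow> (Pair s -` fst F, Pair s -` snd F) \<in> T3_pairs (X s)"
    "F \<in> T2_pairs (sum_topology X S) \<Longrightarrow> (Pair s -` fst F, Pair s -` snd F) \<in> T2_pairs (X s)"
    unfolding T3_pairs_iff T2_pairs_iff fst_conv snd_conv
    using 4 is_singleton_slice[OF _ assms(2)] is_singleton_slice[OF _ assms(3)] by blast+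
qed

lemma finite_support_singleton: "is_singleton F \<Longrightarrow> finite {s. Pair s -` F \<noteq> {}}"
  by (auto simp: is_singleton_def vimage_def)

section \<open>Infinite sums do not admit continuous separation of all disjoint pairs\<close>

text \<open>For a continuous surjection \<open>f\<close> onto a discrete space, the preimage of \<open>A\<close> is the limit, in the
  Vietoris topology, of the preimages of the finite non-empty subsets of \<open>A\<close>.\<close>

lemma vietoris_neighbourhood_of_fibre_union:
  fixes f :: "'a \<Rightarrow> 'b" and X
  defines "fib \<equiv> \<lambda>A. {x \<in> topspace X. f x \<in> A}"
  assumes f: "continuous_map X (discrete_topology B) f" and onto: "f ` topspace X = B"
    and W: "openin (vietoris_topology X) W" "fib A \<in> W" and AB: "A \<subseteq> B"
  shows "\<exists>A'. finite A' \<and> A' \<subseteq> A \<and> (\<forall>C. A' \<subseteq> C \<and> C \<subseteq> A \<and> C \<noteq> {} \<longrightarrow> fib C \<in> W)"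
proof -
  have Cld: "fib C \<in> Cld X" if "C \<subseteq> A" "C \<noteq> {}" for C
  proof -
    have "closedin X (fib C)"
      unfolding fib_def using f that AB by (intro closedin_continuous_map_preimage[OF f]) auto
    moreover have "fib C \<noteq> {}" using that AB onto unfolding fib_def by blast
    ultimately show ?thesis by (simp add: Cld_def)
  qed
  have "generate_topology_on ({{F \<in> Cld X. F \<inter> U \<noteq> {}} | U. openin X U} \<union>
      {{F \<in> Cld X. F \<subseteq> U} | U. openin X U}) W"
    using W(1) unfolding vietoris_topology_def by (rule openin_topology_generated_by)
  then show ?thesis using W(2)
  proof induction
    case Empty
    then show ?case by simp
  next
    case (Int V W)
    then obtain A1 A2 where "finite A1" "A1 \<subseteq> A" "\<forall>C. A1 \<subseteq> C \<and> C \<subseteq> A \<and> C \<noteq> {} \<longrightarrow> fib C \<in> V"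
      "finite A2" "A2 \<subseteq> A" "\<forall>C. A2 \<subseteq> C \<and> C \<subseteq> A \<and> C \<noteq> {} \<longrightarrow> fib C \<in> W" by blast
    then show ?case by (intro exI[of _ "A1 \<union> A2"]) simp
  next
    case (UN K)
    then obtain V where "V \<in> K" "fib A \<in> V" by blast
    moreover from UN.IH[OF this] obtain A' where A': "finite A'" "A' \<subseteq> A"
      "\<forall>C. A' \<subseteq> C \<and> C \<subseteq> A \<and> C \<noteq> {} \<longrightarrow> fib C \<in> V" by (elim exE conjE)
    ultimately have "\<forall>C. A' \<subseteq> C \<and> C \<subseteq> A \<and> C \<noteq> {} \<longrightarrow> fib C \<in> \<Union>K"
      by (meson UnionI)
    with A'(1,2) show ?case by (intro exI[of _ A'] conjI)
  next
    case (Basis V)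
    from Basis.hyps consider U where "V = {F \<in> Cld X. F \<inter> U \<noteq> {}}"
      | U where "V = {F \<in> Cld X. F \<subseteq> U}" by blast
    then show ?case
    proof cases
      case 1
      then obtain x where x: "x \<in> fib A" "x \<in> U" using Basis.prems by blast
      then have "x \<in> fib C" if "f x \<in> C" for C using that by (simp add: fib_def)
      then show ?thesis using x 1 Cld by (intro exI[of _ "{f x}"]) (auto simp: fib_def)
    next
      case 2
      have "fib C \<in> V" if "C \<subseteq> A" "C \<noteq> {}" for C
      proof -
        have "fib C \<subseteq> fib A" using that by (auto simp: fib_def)
        then show ?thesis using 2 Basis.prems Cld[OF that] by blast
      qed
      then show ?thesis by (intro exI[of _ "{}"]) simp
    qed
  qed
qed

text \<open>The hypothesis says that the space is partitioned into a sequence of non-empty open sets, the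
  fibres of \<open>f\<close>.\<close>

lemma not_CT4_if_onto_nat:
  fixes f :: "'a \<Rightarrow> nat"
  assumes f: "continuous_map X (discrete_topology UNIV) f" and onto: "f ` topspace X = UNIV"
  shows "\<not> CT4 X"
proof
  assume "CT4 X"
  then have c: "cont_sep True X (T4_pairs X)"
    by (simp add: CT4_def continuously_separates_iff)
  obtain \<phi> where
    \<phi>1: "continuous_map (subtopology (Cld_square X) (T4_pairs X)) (vietoris_topology X) (\<lambda>F. fst (\<phi> F))" and
    \<phi>2: "continuous_map (subtopology (Cld_square X) (T4_pairs X)) (vietoris_topology X) (\<lambda>F. snd (\<phi> F))" and
    sep: "\<And>F. F \<in> T4_pairs X \<Longrightarrow> separating True X F (\<phi> F)"
    using cont_sepE[OF c] by metis
  let ?Z = "subtopology (Cld_square X) (T4_pairs X)"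
  have topZ: "topspace ?Z = T4_pairs X" using T4_pairs_subset by auto
  define fib where "fib = (\<lambda>A. {x \<in> topspace X. f x \<in> A})"
  have clo: "closedin X (fib A)" "openin X (fib A)" for A
    unfolding fib_def using closedin_continuous_map_preimage[OF f] openin_continuous_map_preimage[OF f] by auto
  have f_fib: "f ` fib A = A" for A
  proof
    show "A \<subseteq> f ` fib A"
    proof
      fix n assume "n \<in> A"
      moreover obtain x where "x \<in> topspace X" "f x = n"
        using onto by (metis UNIV_I imageE)
      ultimately show "n \<in> f ` fib A" by (auto simp: fib_def)
    qed
  qed (auto simp: fib_def)
  have fib_ne: "fib A \<noteq> {}" if "A \<noteq> {}" for A
    using f_fib[of A] that by auto
  have pair: "(fib A, fib B) \<in> T4_pairs X" if "A \<noteq> {}" "B \<noteq> {}" "A \<inter> B = {}" for A B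
    using that clo fib_ne by (auto simp: T4_pairs_def Cld_def fib_def)
  \<comment> \<open>\<open>g\<close> recovers \<open>A\<close> from suitable finite subsets of \<open>A\<close> and of its complement\<close>
  define g where "g = (\<lambda>(A, B). f ` snd (\<phi> (fib A, fib B)))"
  let ?fin = "Collect (finite :: nat set \<Rightarrow> bool)"
  have "A \<in> g ` (?fin \<times> ?fin)" if A: "A \<noteq> {}" "- A \<noteq> {}" for A
  proof -
    define N where "N = {F \<in> T4_pairs X. fst (\<phi> F) \<subseteq> fib (- A)} \<inter> {F \<in> T4_pairs X. snd (\<phi> F) \<subseteq> fib A}"
    have "openin ?Z N"
      using \<phi>1 \<phi>2 clo(2) unfolding continuous_map_vietoris_iff topZ N_def by (blast intro: openin_Int)
    then obtain W where W: "openin (Cld_square X) W" "N = W \<inter> T4_pairs X"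
      by (auto simp: openin_subtopology)
    have FA: "(fib A, fib (- A)) \<in> T4_pairs X" using A by (intro pair) auto
    have "(fib A, fib (- A)) \<in> N"
      using sep[OF FA] FA unfolding N_def separating_def by (auto simp: fib_def)
    then obtain U V where UV: "openin (vietoris_topology X) U" "openin (vietoris_topology X) V"
      "fib A \<in> U" "fib (- A) \<in> V" "U \<times> V \<subseteq> W"
      using W unfolding openin_prod_topology_alt by (metis IntD1)
    obtain A' where A': "finite A'" "A' \<subseteq> A" "\<And>C. \<lbrakk>A' \<subseteq> C; C \<subseteq> A; C \<noteq> {}\<rbrakk> \<Longrightarrow> fib C \<in> U"
      using vietoris_neighbourhood_of_fibre_union[OF f onto UV(1), of A] UV(3) unfolding fib_def by auto
    obtain B' where B': "finite B'" "B' \<subseteq> - A" "\<And>C. \<lbrakk>B' \<subseteq> C; C \<subseteq> - A; C \<noteq> {}\<rbrakk> \<Longrightarrow> fib C \<in> V"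
      using vietoris_neighbourhood_of_fibre_union[OF f onto UV(2), of "- A"] UV(4) unfolding fib_def by auto
    obtain a b where ab: "a \<in> A" "b \<in> - A" using A by blast
    \<comment> \<open>\<open>A'\<close> and \<open>B'\<close> may be empty, but the hyperspace has only non-empty sets\<close>
    let ?A = "insert a A'" and ?B = "insert b B'"
    have T: "(fib ?A, fib ?B) \<in> T4_pairs X" using A' B' ab by (intro pair) auto
    have "(fib ?A, fib ?B) \<in> N"
    proof -
      have "fib ?A \<in> U" using A'(2) ab by (intro A'(3)) auto
      moreover have "fib ?B \<in> V" using B'(2) ab by (intro B'(3)) auto
      ultimately show ?thesis unfolding W(2) using T UV(5) by blast
    qed
    with sep[OF T] have "snd (\<phi> (fib ?A, fib ?B)) = fib A"
      unfolding N_def separating_def by (auto simp: fib_def)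
    then have "g (?A, ?B) = A" by (simp add: g_def f_fib)
    moreover have "(?A, ?B) \<in> ?fin \<times> ?fin" using A' B' by simp
    ultimately show ?thesis by (metis image_eqI)
  qed
  then have "(UNIV :: nat set set) \<subseteq> insert {} (insert UNIV (g ` (?fin \<times> ?fin)))" by blast
  moreover have "countable (insert {} (insert UNIV (g ` (?fin \<times> ?fin))))"
    by (intro countable_insert countable_image countable_SIGMA countable_Collect_finite)
  ultimately have "countable (UNIV :: nat set set)" by (rule countable_subset)
  then obtain h :: "nat \<Rightarrow> nat set" where "range h = UNIV"
    by (metis UNIV_not_empty uncountable_def)
  then show False using Cantors_theorem[of "UNIV :: nat set"] by auto
qed

lemma CT4_sum_imp_finite:
  assumes CT4: "CT4 (sum_topology X S)" and ne: "\<And>s. s \<in> S \<Longrightarrow> topspace (X s) \<noteq> {}"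
  shows "finite S"
proof (rule ccontr)
  assume "infinite S"
  then obtain e :: "nat \<Rightarrow> _" where e: "inj e" "range e \<subseteq> S"
    by (meson infinite_countable_subset)
  let ?f = "\<lambda>p. inv e (fst p)"
  have "continuous_map (sum_topology X S) (discrete_topology UNIV) ?f"
  proof -
    have "openin (X s) {x \<in> topspace (X s). inv e s \<in> U}" for s U
      by (cases "inv e s \<in> U") simp_all
    then show ?thesis
      unfolding continuous_map_def by (auto simp: openin_sum_topology)
  qed
  moreover have "?f ` topspace (sum_topology X S) = UNIV"
  proof -
    have "n \<in> ?f ` topspace (sum_topology X S)" for n
    proof -
      obtain x where "x \<in> topspace (X (e n))" using ne e by blast
      then have "(e n, x) \<in> topspace (sum_topology X S)" using e by auto
      then show ?thesis using e by (intro image_eqI[of _ _ "(e n, x)"]) auto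
    qed
    then show ?thesis by blast
  qed
  ultimately show False using not_CT4_if_onto_nat CT4 by blast
qed

section \<open>The four separation properties of a sum\<close>

lemma T2_pairs_subset: "T2_pairs X \<subseteq> T4_pairs X"
  by (auto simp: T2_pairs_def)

lemma T3_pairs_subset: "T3_pairs X \<subseteq> T4_pairs X"
  by (auto simp: T3_pairs_def)

lemma CT_iff:
  "CT2 X \<longleftrightarrow> cont_sep True X (T2_pairs X)"
  "CT3 X \<longleftrightarrow> cont_sep True X (T3_pairs X)"
  "CT4 X \<longleftrightarrow> cont_sep True X (T4_pairs X)"
  by (simp_all add: CT2_def CT3_def CT4_def continuously_separates_iff T2_pairs_subset T3_pairs_subset)

lemma cont_sep_sum_T2_iff:
  "cont_sep b (sum_topology X S) (T2_pairs (sum_topology X S)) \<longleftrightarrow>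
     (\<forall>s\<in>S. cont_sep b (X s) (T2_pairs (X s)))"
proof
  assume "cont_sep b (sum_topology X S) (T2_pairs (sum_topology X S))"
  then show "\<forall>s\<in>S. cont_sep b (X s) (T2_pairs (X s))"
    by (intro ballI cont_sep_summand[where T' = "T2_pairs (sum_topology X S)"] pairs_image
        subset_trans[OF T2_pairs_subset T4_pairs_subset])
next
  assume "\<forall>s\<in>S. cont_sep b (X s) (T2_pairs (X s))"
  then show "cont_sep b (sum_topology X S) (T2_pairs (sum_topology X S))"
    by (intro cont_sep_sum[where T = "\<lambda>s. T2_pairs (X s)"] pairs_slice
        subset_trans[OF T2_pairs_subset T4_pairs_subset] finite_support_singleton)
      (auto simp: T2_pairs_def)
qed

lemma cont_sep_sum_T3_iff:
  "cont_sep b (sum_topology X S) (T3_pairs (sum_topology X S)) \<longleftrightarrow>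
     (\<forall>s\<in>S. cont_sep b (X s) (T3_pairs (X s)))"
proof
  assume "cont_sep b (sum_topology X S) (T3_pairs (sum_topology X S))"
  then show "\<forall>s\<in>S. cont_sep b (X s) (T3_pairs (X s))"
    by (intro ballI cont_sep_summand[where T' = "T3_pairs (sum_topology X S)"] pairs_image
        subset_trans[OF T3_pairs_subset T4_pairs_subset])
next
  assume "\<forall>s\<in>S. cont_sep b (X s) (T3_pairs (X s))"
  then show "cont_sep b (sum_topology X S) (T3_pairs (sum_topology X S))"
    by (intro cont_sep_sum[where T = "\<lambda>s. T3_pairs (X s)"] pairs_slice
        subset_trans[OF T3_pairs_subset T4_pairs_subset] finite_support_singleton)
      (auto simp: T3_pairs_def)
qed

lemma cont_sep_summand_T4:
  assumes "cont_sep b (sum_topology X S) (T4_pairs (sum_topology X S))" "s \<in> S"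
  shows "cont_sep b (X s) (T4_pairs (X s))"
  using cont_sep_summand[OF assms T4_pairs_subset] pairs_image(1)[OF assms(2)] by blast

lemma cont_sep_sum_T4:
  assumes "finite S" "\<And>s. s \<in> S \<Longrightarrow> cont_sep b (X s) (T4_pairs (X s))"
  shows "cont_sep b (sum_topology X S) (T4_pairs (sum_topology X S))"
proof (rule cont_sep_sum[where T = "\<lambda>s. T4_pairs (X s)"])
  fix F assume "F \<in> T4_pairs (sum_topology X S)"
  then have "{s. Pair s -` fst F \<noteq> {}} \<subseteq> S"
    using T4_pairs_subset_topspace by fastforce
  then show "finite {s. Pair s -` fst F \<noteq> {}}"
    using assms(1) by (rule finite_subset)
qed (rule assms(2) T4_pairs_subset pairs_slice(1); assumption)+

theorem theorem2p6:
  fixes S :: "'s set" and X :: "'s \<Rightarrow> 'a topology"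
  assumes "S \<noteq> {}"
    and "\<And>s. s \<in> S \<Longrightarrow> t1_space (X s)"
    and "\<And>s. s \<in> S \<Longrightarrow> topspace (X s) \<noteq> {}"
  shows "(CT1 (sum_topology X S) \<longleftrightarrow> (\<forall>s\<in>S. CT1 (X s))) \<and>
         (CT2 (sum_topology X S) \<longleftrightarrow> (\<forall>s\<in>S. CT2 (X s))) \<and>
         (CT3 (sum_topology X S) \<longleftrightarrow> (\<forall>s\<in>S. CT3 (X s))) \<and>
         (CT4 (sum_topology X S) \<longleftrightarrow> finite S \<and> (\<forall>s\<in>S. CT4 (X s)))"
proof (intro conjI)
  show "CT1 (sum_topology X S) \<longleftrightarrow> (\<forall>s\<in>S. CT1 (X s))"
    using assms(2) by (simp add: CT1_iff t1_space_sum_topology cont_sep_sum_T2_iff)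
  show "CT2 (sum_topology X S) \<longleftrightarrow> (\<forall>s\<in>S. CT2 (X s))"
    by (simp add: CT_iff cont_sep_sum_T2_iff)
  show "CT3 (sum_topology X S) \<longleftrightarrow> (\<forall>s\<in>S. CT3 (X s))"
    by (simp add: CT_iff cont_sep_sum_T3_iff)
  show "CT4 (sum_topology X S) \<longleftrightarrow> finite S \<and> (\<forall>s\<in>S. CT4 (X s))"
    using CT4_sum_imp_finite[of X S] assms(3) cont_sep_summand_T4[of True X S]
      cont_sep_sum_T4[of S True X]
    unfolding CT_iff by blast
qed

end
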